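(* Let $x \in \mathbb{R}^n$ satisfy $(L_f + L_G)\|x\| < \|G(0)^{\dagger}\|^{-1}$. Define $$\bar{\mathcal{V}}^{\mathcal{G}}_{x} = \mathbb{B}^{n}\big(f(0);\ \|G(0)^{\dagger}\|^{-1} - L_f\|x\| - L_G\|x\|\big) \cap \mathrm{Im}(G(0)).$$ Then $\bar{\mathcal{V}}^{\mathcal{G}}_{x} \subseteq \mathcal{V}^{\mathcal{G}}_{x}$.
   Context: Notation: $\|v\|$ is the Euclidean norm of a vector $v$; $\|M\|=\max_{\|v\|=1}\|Mv\|$ for a matrix $M$; $M^\dagger$ is the Moore-Penrose pseudoinverse; $\mathrm{Im}(M)$ is the range of $M$; $\mathbb{B}^n(a;b)$ is the closed Euclidean ball in $\mathbb{R}^n$ with center $a$ and radius $b\ge 0$; for $\mathcal{X}\subseteq\mathbb{R}^m$, $a+B\mathcal{X}=\{a+Bv \mid v\in\mathcal{X}\}$. A function $h$ has Lipschitz constant $L$ if $\|h(x)-h(y)\|\le L\|x-y\|$ for all $x,y\in\mathbb{R}^n$. Setting: $L_f>0$ and $L_G>0$ are given; $f:\mathbb{R}^n\to\mathbb{R}^n$ is Lipschitz with constant $L_f$ and $G:\mathbb{R}^n\to\mathbb{R}^{n\times m}$ is Lipschitz with constant $L_G$ (with respect to the matrix norm $\|M\|=\max_{\|v\|=1}\|Mv\|$); $\mathcal{U}=\mathbb{B}^m(0;1)$. There exist $R\in\mathbb{R}^{n\times m}$ and functions $r:\mathbb{R}^n\to\mathbb{R}^m$, $H:\mathbb{R}^n\to\mathbb{R}^{m\times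 m}$ with $f(x)=Rr(x)$ and $G(x)=RH(x)$ for all $x$, and $H(0)$ invertible (Assumption 1). The values $f(0)$, $G(0)$ and the bounds $L_f,L_G$ are known, and $G(0)\neq 0$ (Assumption 2). Consistent systems: $\mathcal{D}_{con}$ is the set of all pairs $(\hat f,\hat G)$ such that $\hat f:\mathbb{R}^n\to\mathbb{R}^n$ is Lipschitz with constant $L_f$, $\hat G:\mathbb{R}^n\to\mathbb{R}^{n\times m}$ is Lipschitz with constant $L_G$, $\hat f(0)=f(0)$, $\hat G(0)=G(0)$, and there exist $R'\in\mathbb{R}^{n\times m}$, $r':\mathbb{R}^n\to\mathbb{R}^m$, $H':\mathbb{R}^n\to\mathbb{R}^{m\times m}$ with $\hat f=R'r'$, $\hat G=R'H'$ and $H'(0)$ invertible. Guaranteed velocity set at $x\in\mathbb{R}^n$: $\mathcal{V}^{\mathcal{G}}_x=\bigcap_{(\hat f,\hat G)\in\mathcal{D}_{con}}\big(\hat f(x)+\hat G(x)\mathcal{U}\big)$. *)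

theory Defs
  imports "HOL-Analysis.Analysis"
begin

text \<open>
  The type \<^typ>\<open>real ^ 'm ^ 'n\<close> is that of matrices with \<open>n\<close> rows and \<open>m\<close> columns.
  Its library norm is the Frobenius norm; the spectral norm is the operator norm of
  the induced linear map.
\<close>

abbreviation mat_norm :: "real ^ 'm ^ 'n \<Rightarrow> real"
  where "mat_norm A \<equiv> onorm ((*v) A)"

lemma mat_norm_is_max_on_sphere:
  fixes A :: "real ^ 'm ^ 'n"
  shows "\<exists>v. norm v = 1 \<and> norm (A *v v) = mat_norm A"
    and "norm v = 1 \<Longrightarrow> norm (A *v v) \<le> mat_norm A"
proof -
  have bl: "bounded_linear ((*v) A)" by simp
  have le: "norm (A *v v) \<le> mat_norm A" if "norm v = 1" for v
    using onorm[OF bl, of v] that by simp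
  have ne: "sphere (0 :: real ^ 'm) 1 \<noteq> {}" by simp
  have "continuous_on (sphere 0 1) (\<lambda>v. norm (A *v v))"
    by (intro continuous_on_norm linear_continuous_on bl)
  then obtain v0 where v0: "v0 \<in> sphere 0 1"
      and max: "\<And>v. v \<in> sphere 0 1 \<Longrightarrow> norm (A *v v) \<le> norm (A *v v0)"
    using continuous_attains_sup[OF compact_sphere ne] by blast
  have "mat_norm A \<le> norm (A *v v0)"
  proof (rule onorm_bound)
    fix v :: "real ^ 'm"
    show "norm (A *v v) \<le> norm (A *v v0) * norm v"
    proof (cases "v = 0")
      case False
      have "norm (A *v ((1 / norm v) *\<^sub>R v)) \<le> norm (A *v v0)"
        using False by (intro max) simp
      then show ?thesis
        using False by (simp add: matrix_vector_mult_scaleR divide_simps)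
    qed simp
  qed simp
  then show "\<exists>v. norm v = 1 \<and> norm (A *v v) = mat_norm A"
    using le[of v0] v0 by (intro exI[of _ v0]) simp
  show "norm v = 1 \<Longrightarrow> norm (A *v v) \<le> mat_norm A" by (rule le)
qed

definition is_pinv :: "real ^ 'm ^ 'n \<Rightarrow> real ^ 'n ^ 'm \<Rightarrow> bool"
  where "is_pinv A X \<longleftrightarrow>
    A ** X ** A = A \<and> X ** A ** X = X \<and>
    transpose (A ** X) = A ** X \<and> transpose (X ** A) = X ** A"

lemma is_pinv_unique:
  assumes "is_pinv A X" "is_pinv A Y"
  shows "X = Y"
proof -
  note X = assms(1)[unfolded is_pinv_def] and Y = assms(2)[unfolded is_pinv_def]
  have "A ** X = transpose (A ** Y ** (A ** X))"
    using X Y by (metis matrix_mul_assoc)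
  also have "\<dots> = (A ** X) ** (A ** Y)"
    using X Y by (simp add: matrix_transpose_mul)
  also have "\<dots> = A ** Y"
    using X by (metis matrix_mul_assoc)
  finally have AX: "A ** X = A ** Y" .
  have "X ** A = transpose (X ** A ** (Y ** A))"
    using X Y by (metis matrix_mul_assoc)
  also have "\<dots> = (Y ** A) ** (X ** A)"
    using X Y by (simp add: matrix_transpose_mul)
  also have "\<dots> = Y ** A"
    using X by (metis matrix_mul_assoc)
  finally have XA: "X ** A = Y ** A" .
  have "X = X ** (A ** X)" using X by (metis matrix_mul_assoc)
  also have "\<dots> = Y ** (A ** Y)" using AX XA by (metis matrix_mul_assoc)
  also have "\<dots> = Y" using Y by (metis matrix_mul_assoc)
  finally show ?thesis .
qed

lemma is_pinv_exists:
  fixes A :: "real ^ 'm ^ 'n"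
  shows "\<exists>X. is_pinv A X"
proof -
  let ?R = "range ((*v) A)" and ?T = "range ((*v) (transpose A))"
  have lin: "linear ((*v) B)" for B :: "real ^ 'c ^ 'd" by simp
  have sR: "subspace ?R" and sT: "subspace ?T"
    by (rule linear_subspace_image[OF lin subspace_UNIV])+
  have adj: "(A *v z) \<bullet> y = z \<bullet> (transpose A *v y)" for z y
    by (metis dot_lmul_matrix inner_commute transpose_matrix_vector)
  have decomp: "\<exists>p\<in>S. \<forall>s\<in>S. s \<bullet> (y - p) = 0"
    if "subspace S" for S :: "'c :: euclidean_space set" and y
  proof -
    obtain p w where "p \<in> span S" "\<And>s. s \<in> span S \<Longrightarrow> orthogonal w s" "y = p + w"
      using orthogonal_subspace_decomp_exists[of S y] by blast
    then show ?thesis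
      using that by (intro bexI[of _ p]) (auto simp: orthogonal_def inner_commute span_eq_iff[THEN iffD2])
  qed
  define P where "P y x \<longleftrightarrow> x \<in> ?T \<and> (\<forall>z. (A *v z) \<bullet> (y - A *v x) = 0)" for y x
  have ex: "\<exists>x. P y x" for y
  proof -
    obtain w where w: "\<forall>z. (A *v z) \<bullet> (y - A *v w) = 0"
      using decomp[OF sR, of y] by blast
    obtain x where x: "x \<in> ?T" "\<forall>s\<in>?T. s \<bullet> (w - x) = 0"
      using decomp[OF sT, of w] by blast
    have "(A *v (w - x)) \<bullet> (A *v (w - x)) = 0"
      unfolding adj using x(2) by (metis inner_commute rangeI)
    then have "A *v w = A *v x" by (simp add: matrix_vector_mult_diff_distrib)
    with w x(1) show ?thesis unfolding P_def by auto
  qed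
  have uniq: "x = x'" if "P y x" "P y x'" for y x x'
  proof -
    have "(A *v (x - x')) \<bullet> ((y - A *v x') - (y - A *v x)) = 0"
      using that unfolding P_def by (simp add: inner_diff_right)
    then have 0: "A *v (x - x') = 0" by (simp add: matrix_vector_mult_diff_distrib)
    have "x - x' \<in> ?T" using that sT unfolding P_def by (simp add: subspace_diff)
    then obtain t where t: "x - x' = transpose A *v t" by blast
    have "(x - x') \<bullet> (x - x') = 0"
      by (subst (2) t) (metis adj 0 inner_zero_left)
    then show ?thesis by simp
  qed
  define g where "g y = (SOME x. P y x)" for y
  have g: "P y (g y)" for y unfolding g_def by (rule someI_ex[OF ex])
  have gT: "g y \<in> ?T" and gO: "(A *v z) \<bullet> (A *v g y) = (A *v z) \<bullet> y" for y z
    using g[of y] unfolding P_def by (auto simp: inner_diff_right)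
  have "linear g"
  proof (rule linearI)
    show "g (a + b) = g a + g b" for a b
      using subspace_add[OF sT gT gT, of a b]
      by (intro uniq[OF g]) (simp add: P_def gO
          matrix_vector_right_distrib inner_diff_right inner_add_right)
    show "g (c *\<^sub>R b) = c *\<^sub>R g b" for c b
      using subspace_scale[OF sT gT, of c b]
      by (intro uniq[OF g]) (simp add: P_def gO
          matrix_vector_mult_scaleR inner_diff_right)
  qed
  then have X: "matrix g *v y = g y" for y by (simp add: matrix_works)
  have AgA: "A *v g (A *v z) = A *v z" for z
  proof -
    have "(A *v (g (A *v z) - z)) \<bullet> (A *v g (A *v z) - A *v z) = 0"
      by (simp only: inner_diff_right gO)
    then show ?thesis by (simp add: matrix_vector_mult_diff_distrib)
  qed
  have gAg: "g (A *v g y) = g y" for y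
    using gT[of y] by (intro uniq[OF g]) (simp add: P_def)
  have symI: "transpose B = B" if "\<And>u v. (B *v u) \<bullet> v = u \<bullet> (B *v v)"
    for B :: "real ^ 'c ^ 'c"
  proof -
    have "u \<bullet> (transpose B *v v) = u \<bullet> (B *v v)" for u v
      by (metis that dot_lmul_matrix inner_commute transpose_matrix_vector)
    then have "transpose B *v v = B *v v" for v
      by (metis vector_eq_rdot inner_commute)
    then show ?thesis by (simp add: matrix_eq)
  qed
  have gA: "(g (A *v u)) \<bullet> v = g (A *v u) \<bullet> g (A *v v)" for u v
  proof -
    obtain t where t: "g (A *v u) = transpose A *v t" using gT by blast
    show ?thesis unfolding t by (metis adj AgA inner_commute)
  qed
  have "is_pinv A (matrix g)"
    unfolding is_pinv_def
  proof (intro conjI)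
    show "A ** matrix g ** A = A"
      by (simp add: matrix_eq X AgA flip: matrix_vector_mul_assoc)
    show "matrix g ** A ** matrix g = matrix g"
      by (simp add: matrix_eq X gAg flip: matrix_vector_mul_assoc)
    show "transpose (A ** matrix g) = A ** matrix g"
      by (rule symI) (simp add: X flip: matrix_vector_mul_assoc, metis gO inner_commute)
    show "transpose (matrix g ** A) = matrix g ** A"
      by (rule symI) (simp add: X flip: matrix_vector_mul_assoc, metis gA inner_commute)
  qed
  then show ?thesis ..
qed

definition pinv :: "real ^ 'm ^ 'n \<Rightarrow> real ^ 'n ^ 'm"
  where "pinv A = (THE X. is_pinv A X)"

lemma is_pinv_pinv: "is_pinv A (pinv A)"
  unfolding pinv_def using is_pinv_exists is_pinv_unique by (metis theI)

text \<open>Lipschitz continuity of a matrix-valued map in the spectral norm, for which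
  \<^const>\<open>lipschitz_on\<close> (Frobenius norm) is not the right notion.\<close>

definition mat_lipschitz :: "real \<Rightarrow> (real ^ 'n \<Rightarrow> real ^ 'm ^ 'n) \<Rightarrow> bool"
  where "mat_lipschitz L G \<longleftrightarrow> (\<forall>x y. mat_norm (G x - G y) \<le> L * norm (x - y))"

definition common_factor :: "(real ^ 'n \<Rightarrow> real ^ 'n) \<Rightarrow> (real ^ 'n \<Rightarrow> real ^ 'm ^ 'n) \<Rightarrow> bool"
  where "common_factor f G \<longleftrightarrow>
    (\<exists>(R :: real ^ 'm ^ 'n) (r :: real ^ 'n \<Rightarrow> real ^ 'm) (H :: real ^ 'n \<Rightarrow> real ^ 'm ^ 'm).
      (\<forall>x. f x = R *v r x) \<and> (\<forall>x. G x = R ** H x) \<and> invertible (H 0))"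

definition consistent_systems ::
  "real \<Rightarrow> real \<Rightarrow> (real ^ 'n \<Rightarrow> real ^ 'n) \<Rightarrow> (real ^ 'n \<Rightarrow> real ^ 'm ^ 'n)
    \<Rightarrow> ((real ^ 'n \<Rightarrow> real ^ 'n) \<times> (real ^ 'n \<Rightarrow> real ^ 'm ^ 'n)) set"
  where "consistent_systems Lf LG f G =
    {(f', G'). Lf-lipschitz_on UNIV f' \<and> mat_lipschitz LG G' \<and>
      f' 0 = f 0 \<and> G' 0 = G 0 \<and> common_factor f' G'}"

definition guaranteed_velocity_set ::
  "real \<Rightarrow> real \<Rightarrow> (real ^ 'n \<Rightarrow> real ^ 'n) \<Rightarrow> (real ^ 'n \<Rightarrow> real ^ 'm ^ 'n)
    \<Rightarrow> real ^ 'n \<Rightarrow> (real ^ 'n) set"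
  where "guaranteed_velocity_set Lf LG f G x =
    (\<Inter>(f', G') \<in> consistent_systems Lf LG f G. {f' x + G' x *v u | u. u \<in> cball 0 1})"

definition guaranteed_velocity_ball ::
  "real \<Rightarrow> real \<Rightarrow> (real ^ 'n \<Rightarrow> real ^ 'n) \<Rightarrow> (real ^ 'n \<Rightarrow> real ^ 'm ^ 'n)
    \<Rightarrow> real ^ 'n \<Rightarrow> (real ^ 'n) set"
  where "guaranteed_velocity_ball Lf LG f G x =
    cball (f 0) (inverse (mat_norm (pinv (G 0))) - Lf * norm x - LG * norm x)
      \<inter> range ((*v) (G 0))"

end

theory Submission
  imports Defs
begin

text \<open>
  Write \<open>A = G 0\<close> and \<open>W = Im A\<close>. For every consistent system \<open>(f', G')\<close> the invertibility of
  \<open>H' 0\<close> forces the common factor \<open>R'\<close> to have the same range \<open>W\<close> as \<open>A\<close>, so that both \<open>f' x\<close>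
  and the range of \<open>G' x\<close> lie in \<open>W\<close>: no consistent system can move the state out of \<open>W\<close>, and
  hitting a target velocity \<open>y \<in> W\<close> means solving \<open>G' x *v u = w\<close> for \<open>w = y - f' x \<in> W\<close>.

  The matrix \<open>G' x\<close> is a perturbation of \<open>A\<close> of spectral size at most \<open>L\<^sub>G \<parallel>x\<parallel>\<close>, which is below
  \<open>1 / \<parallel>pinv A\<parallel>\<close>, the least factor by which \<open>A\<close> stretches vectors orthogonal to its kernel.
  Such a perturbation keeping the range inside \<open>W\<close> still maps onto \<open>W\<close>, and the least stretching
  factor drops at most by the size of the perturbation (\<open>perturbed_solution_exists\<close>). Hence the
  equation has a solution with \<open>(1 / \<parallel>pinv A\<parallel> - L\<^sub>G \<parallel>x\<parallel>) \<parallel>u\<parallel> \<le> \<parallel>w\<parallel>\<close>. Since \<open>f' x\<close> is within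
  \<open>L\<^sub>f \<parallel>x\<parallel>\<close> of \<open>f 0\<close>, the choice of the radius of the ball makes the right-hand side at most
  \<open>1 / \<parallel>pinv A\<parallel> - L\<^sub>G \<parallel>x\<parallel>\<close>, so \<open>u\<close> is an admissible input.
\<close>

lemma range_matrix_mult_invertible:
  fixes R :: "real ^ 'm ^ 'n" and H :: "real ^ 'm ^ 'm"
  assumes "invertible H"
  shows "range ((*v) (R ** H)) = range ((*v) R)"
proof
  have "(R ** H) *v v = R *v (H *v v)" for v
    by (simp add: matrix_vector_mul_assoc)
  then show "range ((*v) (R ** H)) \<subseteq> range ((*v) R)"
    by auto
  obtain K where "H ** K = mat 1"
    using assms unfolding invertible_def by blast
  then have "R *v v = (R ** H) *v (K *v v)" for v
    by (metis matrix_mul_assoc matrix_mul_rid matrix_vector_mul_assoc)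
  then show "range ((*v) R) \<subseteq> range ((*v) (R ** H))"
    by auto
qed

text \<open>
  Every value of \<open>f\<close> and \<open>G\<close> passes through the common factor \<open>R\<close>, and \<open>G 0\<close> has the same
  range as \<open>R\<close> because \<open>H 0\<close> is invertible; the matrix \<open>H x\<close> elsewhere may be singular.
\<close>

lemma common_factor_ranges:
  fixes f :: "real ^ 'n \<Rightarrow> real ^ 'n" and G :: "real ^ 'n \<Rightarrow> real ^ 'm ^ 'n"
  assumes "common_factor f G"
  shows "f x \<in> range ((*v) (G 0))" and "range ((*v) (G x)) \<subseteq> range ((*v) (G 0))"
proof -
  obtain R :: "real ^ 'm ^ 'n" and r H
    where f: "\<And>x. f x = R *v r x" and G: "\<And>x. G x = R ** H x" and inv: "invertible (H 0)"
    using assms unfolding common_factor_def by blast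
  have R: "range ((*v) (G 0)) = range ((*v) R)"
    unfolding G by (rule range_matrix_mult_invertible[OF inv])
  show "f x \<in> range ((*v) (G 0))"
    unfolding R f by simp
  have "G x *v v = R *v (H x *v v)" for v
    unfolding G by (simp add: matrix_vector_mul_assoc)
  then show "range ((*v) (G x)) \<subseteq> range ((*v) (G 0))"
    unfolding R by auto
qed

lemma matrix_mult_pinv_on_range:
  assumes "z \<in> range ((*v) A)"
  shows "A *v (pinv A *v z) = z"
  using assms is_pinv_pinv[of A] unfolding is_pinv_def
  by (auto simp: matrix_vector_mul_assoc matrix_mul_assoc)

lemma norm_matrix_vector_le: "norm (A *v v) \<le> mat_norm A * norm v"
  by (rule onorm) simp

text \<open>
  Look for a solution of the form \<open>u = pinv A *v z\<close> with \<open>z\<close> in the range of \<open>A\<close>. On that range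
  \<open>A\<close> undoes \<open>pinv A\<close>, so with \<open>E = B - A\<close> the equation becomes \<open>z + E *v (pinv A *v z) = w\<close>.
  The operator on the left is injective because \<open>E *v (pinv A *v z)\<close> is shorter than \<open>z\<close>, hence
  it is onto; and its preimage of \<open>w\<close> lies in the range of \<open>A\<close> because \<open>w\<close> and the range of \<open>E\<close> do.
  The norm bound combines \<open>\<parallel>u\<parallel> \<le> \<parallel>pinv A\<parallel> \<parallel>z\<parallel>\<close> with \<open>z = w - E *v u\<close>; estimating \<open>z\<close> through
  \<open>u\<close> and not through itself avoids dividing by \<open>1 - \<parallel>pinv A\<parallel> \<parallel>E\<parallel>\<close>.
\<close>

lemma perturbed_solution_exists:
  fixes A B :: "real ^ 'm ^ 'n"
  assumes ran: "range ((*v) B) \<subseteq> range ((*v) A)"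
    and small: "mat_norm (pinv A) * mat_norm (B - A) < 1"
    and w: "w \<in> range ((*v) A)"
  shows "\<exists>u. B *v u = w \<and>
    (1 - mat_norm (pinv A) * mat_norm (B - A)) * norm u \<le> mat_norm (pinv A) * norm w"
proof -
  let ?c = "mat_norm (pinv A)" and ?e = "mat_norm (B - A)"
  define T where "T = mat 1 + (B - A) ** pinv A"
  have c0: "0 \<le> ?c" and e0: "0 \<le> ?e"
    by (simp_all add: onorm_pos_le)
  have T: "T *v z = z + (B - A) *v (pinv A *v z)" for z
    unfolding T_def by (simp add: matrix_vector_mult_add_rdistrib matrix_vector_mul_assoc)
  have sub: "subspace (range ((*v) A))"
    by (rule linear_subspace_image[OF _ subspace_UNIV]) simp
  have "z = 0" if "T *v z = 0" for z
  proof -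
    have "norm z = norm ((B - A) *v (pinv A *v z))"
      using that unfolding T by (metis add_eq_0_iff norm_minus_cancel)
    also have "\<dots> \<le> ?e * norm (pinv A *v z)"
      by (rule norm_matrix_vector_le)
    also have "\<dots> \<le> ?e * (?c * norm z)"
      by (intro mult_left_mono norm_matrix_vector_le e0)
    finally have "(1 - ?c * ?e) * norm z \<le> 0"
      by (simp add: algebra_simps)
    then show "z = 0"
      using small by (simp add: mult_le_0_iff)
  qed
  then have "inj ((*v) T)"
    by (subst linear_injective_0) auto
  then have "surj ((*v) T)"
    by (intro linear_inj_imp_surj) simp_all
  then obtain z where z: "T *v z = w"
    by (metis surjD)
  define u where "u = pinv A *v z"
  have zw: "z = w - (B - A) *v u"
    using z unfolding T u_def by (simp add: algebra_simps)
  have "(B - A) *v u \<in> range ((*v) A)"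
    unfolding matrix_vector_mult_diff_rdistrib using ran by (intro subspace_diff[OF sub]) auto
  then have "z \<in> range ((*v) A)"
    unfolding zw by (rule subspace_diff[OF sub w])
  then have "A *v u = z"
    unfolding u_def by (rule matrix_mult_pinv_on_range)
  then have Bu: "B *v u = w"
    using zw by (simp add: matrix_vector_mult_diff_rdistrib)
  have "norm z \<le> norm w + ?e * norm u"
    unfolding zw using norm_triangle_ineq4[of w] norm_matrix_vector_le[of "B - A" u] by (rule order_trans[OF _ add_left_mono])
  then have "?c * norm z \<le> ?c * (norm w + ?e * norm u)"
    by (rule mult_left_mono[OF _ c0])
  moreover have "norm u \<le> ?c * norm z"
    unfolding u_def by (rule norm_matrix_vector_le)
  ultimately have "(1 - ?c * ?e) * norm u \<le> ?c * norm w"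
    by (simp add: algebra_simps)
  with Bu show ?thesis by blast
qed

theorem theorem1:
  fixes f :: "real ^ 'n \<Rightarrow> real ^ 'n"
    and G :: "real ^ 'n \<Rightarrow> real ^ 'm ^ 'n"
    and Lf LG :: real
    and x :: "real ^ 'n"
  assumes "Lf > 0" and "LG > 0"
    and "Lf-lipschitz_on UNIV f"
    and "mat_lipschitz LG G"
    and "common_factor f G"
    and "G 0 \<noteq> 0"
    and "(Lf + LG) * norm x < inverse (mat_norm (pinv (G 0)))"
  shows "guaranteed_velocity_ball Lf LG f G x \<subseteq> guaranteed_velocity_set Lf LG f G x"
proof -
  let ?c = "mat_norm (pinv (G 0))" and ?W = "range ((*v) (G 0))"
  have "0 \<le> (Lf + LG) * norm x"
    using assms(1,2) by simp
  \<comment> \<open>Since \<open>inverse 0 = 0\<close>, a positive inverse excludes that the pseudoinverse has norm zero.\<close>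
  then have c: "0 < ?c"
    using assms(7) by (metis inverse_positive_iff_positive order_le_less_trans)
  have "0 \<le> Lf * norm x"
    using assms(1) by simp
  then have "LG * norm x < inverse ?c"
    using assms(7) by (simp add: distrib_right)
  then have cL: "?c * (LG * norm x) < 1"
    using c by (simp add: field_simps)
  have "\<exists>u\<in>cball 0 1. y = f' x + G' x *v u"
    if y: "y \<in> guaranteed_velocity_ball Lf LG f G x"
      and sys: "(f', G') \<in> consistent_systems Lf LG f G" for y f' G'
  proof -
    have lip: "Lf-lipschitz_on UNIV f'" and mlip: "mat_lipschitz LG G'"
      and f0: "f' 0 = f 0" and G0: "G' 0 = G 0" and cf: "common_factor f' G'"
      using sys unfolding consistent_systems_def by auto
    define w where "w = y - f' x"
    define e where "e = mat_norm (G' x - G 0)"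
    have yW: "y \<in> ?W"
      and yball: "norm (y - f 0) \<le> inverse ?c - Lf * norm x - LG * norm x"
      using y unfolding guaranteed_velocity_ball_def by (auto simp: dist_norm norm_minus_commute)
    have "subspace ?W"
      by (rule linear_subspace_image[OF _ subspace_UNIV]) simp
    then have wW: "w \<in> ?W"
      unfolding w_def using yW common_factor_ranges(1)[OF cf] G0 by (simp add: subspace_diff)
    have "norm (f' x - f 0) \<le> Lf * norm x"
      using lipschitz_onD[OF lip, of x 0] f0 by (simp add: dist_norm)
    moreover have "norm w \<le> norm (y - f 0) + norm (f' x - f 0)"
      unfolding w_def using norm_triangle_ineq4[of "y - f 0" "f' x - f 0"] by simp
    ultimately have "norm w \<le> inverse ?c - LG * norm x"
      using yball by linarith
    then have "?c * norm w \<le> ?c * (inverse ?c - LG * norm x)"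
      using c by (intro mult_left_mono) auto
    then have cw: "?c * norm w \<le> 1 - ?c * (LG * norm x)"
      using c by (simp add: right_diff_distrib)
    have "e \<le> LG * norm x"
      using mlip[unfolded mat_lipschitz_def, rule_format, of x 0] by (simp add: G0 e_def)
    then have ce: "?c * e \<le> ?c * (LG * norm x)"
      using c by (intro mult_left_mono) auto
    have "range ((*v) (G' x)) \<subseteq> ?W"
      using common_factor_ranges(2)[OF cf, of x] G0 by simp
    then obtain u where u: "G' x *v u = w" and bound: "(1 - ?c * e) * norm u \<le> ?c * norm w"
      using perturbed_solution_exists[of "G' x" "G 0" w] wW ce cL unfolding e_def
      by (meson order_le_less_trans)
    have "(1 - ?c * e) * norm u \<le> (1 - ?c * e) * 1"
      unfolding mult_1_right
      by (rule order_trans[OF bound order_trans[OF cw diff_left_mono[OF ce]]])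
    moreover have "0 < 1 - ?c * e"
      using ce cL by linarith
    ultimately have "norm u \<le> 1"
      by (simp only: mult_le_cancel_left_pos)
    then show ?thesis
      using u unfolding w_def by (intro bexI[of _ u]) auto
  qed
  then show ?thesis
    unfolding guaranteed_velocity_set_def by blast
qed

end
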